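(* Let $p$ be a prime. The generalised lamplighter group $G=(\mathbb{Z}/p\mathbb{Z})\wr\mathbb{Z}$ does not have Property $(\tau)$ with respect to any infinite collection of (distinct) finite index subgroups.
   Context: $(\mathbb{Z}/p\mathbb{Z})\wr\mathbb{Z}$ is the semi-direct product $(\bigoplus_{-\infty}^{\infty}(\mathbb{Z}/p\mathbb{Z}))\rtimes\mathbb{Z}$, where $n\in\mathbb{Z}$ acts by shifting the indexing set $n$ to the right (elements of the direct sum have only finitely many non-zero coordinates). Property $(\tau)$: for a finite graph $X$ with vertex set $V(X)$ (loops and multiple edges allowed) and $A \subset V(X)$, $\partial A$ is the set of edges with one endpoint in $A$ and one not in $A$. The Cheeger constant is $h(X) = \min\{|\partial A|/|A| : A \subset V(X),\ 0<|A|\leq |V(X)|/2\}$ (a one-vertex graph is given $h=+\infty$). For a finite generating set $S$ of $G$ and a finite index subgroup $G_i$, $X(G/G_i;S)$ is the Schreier coset graph: vertices are the right cosets $G_i g$, with one edge from $G_i g$ to $G_i g s$ for each coset and each $s\in S$. A finitely generated group $G$ has Property $(\tau)$ with respect to a collection $\{G_i\}$ of finite index subgroups if $\inf_i h(X(G/G_i;S))>0$ for some (equivalently, any) finite generating set $S$ of $G$. *)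

theory Defs
  imports
    "HOL-Algebra.Product_Groups"
    "HOL-Computational_Algebra.Primes"
    "HOL-Library.Extended_Real"
    "Graph_Theory.Digraph"
begin

definition semidirect_product ::
    "('a, 'c) monoid_scheme \<Rightarrow> ('b, 'd) monoid_scheme \<Rightarrow> ('b \<Rightarrow> 'a \<Rightarrow> 'a) \<Rightarrow> ('a \<times> 'b) monoid" where
  "semidirect_product N K \<phi> =
     \<lparr>carrier = carrier N \<times> carrier K,
      monoid.mult = (\<lambda>(x, k) (y, l). (x \<otimes>\<^bsub>N\<^esub> \<phi> k y, k \<otimes>\<^bsub>K\<^esub> l)),
      one = (\<one>\<^bsub>N\<^esub>, \<one>\<^bsub>K\<^esub>)\<rparr>"

text \<open>The coordinate at \<open>i\<close> moves to \<open>i + n\<close>.\<close>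

definition shift :: "int \<Rightarrow> (int \<Rightarrow> 'a) \<Rightarrow> (int \<Rightarrow> 'a)" where
  "shift n f = (\<lambda>i. f (i - n))"

definition lamplighter_group :: "nat \<Rightarrow> ((int \<Rightarrow> int) \<times> int) monoid" where
  "lamplighter_group p =
     semidirect_product (sum_group UNIV (\<lambda>_. integer_mod_group p)) integer_group shift"

lemma group_lamplighter_group: "group (lamplighter_group p)"
proof -
  let ?Z = "integer_mod_group p"
  let ?N = "sum_group (UNIV :: int set) (\<lambda>_. ?Z)"
  interpret N: group ?N by simp
  have carr: "carrier ?N = {f. (\<forall>i. f i \<in> carrier ?Z) \<and> finite {i. f i \<noteq> \<one>\<^bsub>?Z\<^esub>}}"
    by (auto simp: carrier_sum_group PiE_def)
  have shift_closed: "shift n f \<in> carrier ?N" if "f \<in> carrier ?N" for n f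
  proof -
    have "{i. shift n f i \<noteq> \<one>\<^bsub>?Z\<^esub>} = (\<lambda>i. i + n) ` {i. f i \<noteq> \<one>\<^bsub>?Z\<^esub>}"
      by (force simp: shift_def image_iff intro: exI [of _ "_ - n"])
    with that show ?thesis by (auto simp: carr shift_def)
  qed
  have shift_mult: "shift n (f \<otimes>\<^bsub>?N\<^esub> g) = shift n f \<otimes>\<^bsub>?N\<^esub> shift n g" for n f g
    by (simp add: shift_def fun_eq_iff)
  have shift_shift: "shift m (shift n f) = shift (m + n) f" for m n and f :: "int \<Rightarrow> int"
    by (simp add: shift_def algebra_simps)
  have shift_0: "shift 0 f = f" for f :: "int \<Rightarrow> int"
    by (simp add: shift_def)
  show ?thesis
  proof (rule groupI)
    fix x assume "x \<in> carrier (lamplighter_group p)"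
    then obtain f n where x: "x = (f, n)" "f \<in> carrier ?N"
      by (auto simp: lamplighter_group_def semidirect_product_def)
    let ?y = "(shift (- n) (inv\<^bsub>?N\<^esub> f), - n)"
    have "shift (- n) (inv\<^bsub>?N\<^esub> f) \<otimes>\<^bsub>?N\<^esub> shift (- n) f = shift (- n) \<one>\<^bsub>?N\<^esub>"
      using x by (simp only: shift_mult [symmetric] N.l_inv)
    then have "?y \<otimes>\<^bsub>lamplighter_group p\<^esub> x = \<one>\<^bsub>lamplighter_group p\<^esub>"
      using x by (simp add: lamplighter_group_def semidirect_product_def shift_def restrict_def)
    moreover have "?y \<in> carrier (lamplighter_group p)"
      using x shift_closed N.inv_closed
      by (simp add: lamplighter_group_def semidirect_product_def del: carrier_sum_group)
    ultimately show "\<exists>y\<in>carrier (lamplighter_group p).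
        y \<otimes>\<^bsub>lamplighter_group p\<^esub> x = \<one>\<^bsub>lamplighter_group p\<^esub>" by blast
  qed (auto simp: lamplighter_group_def semidirect_product_def shift_closed shift_mult shift_shift
        shift_0 N.m_assoc simp del: mult_sum_group one_sum_group carrier_sum_group)
qed

text \<open>
  Edges are counted as elements of \<open>arcs X\<close>, so parallel edges count with multiplicity and
  the orientation plays no role.
\<close>

definition edge_boundary :: "('a, 'b) pre_digraph \<Rightarrow> 'a set \<Rightarrow> 'b set" where
  "edge_boundary X A = {e \<in> arcs X. (tail X e \<in> A) \<noteq> (head X e \<in> A)}"

text \<open>
  For a finite graph the infimum ranges over a finite set, so it is a minimum, except for a
  one-vertex graph, where no \<open>A\<close> is admissible and the value is \<open>\<infinity>\<close>.
\<close>

definition cheeger_constant :: "('a, 'b) pre_digraph \<Rightarrow> ereal" where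
  "cheeger_constant X =
     Inf {ereal (real (card (edge_boundary X A)) / real (card A)) | A.
            A \<subseteq> verts X \<and> 0 < card A \<and> real (card A) \<le> real (card (verts X)) / 2}"

definition schreier_coset_graph ::
    "('a, 'c) monoid_scheme \<Rightarrow> 'a set \<Rightarrow> 'a set \<Rightarrow> ('a set, 'a set \<times> 'a) pre_digraph" where
  "schreier_coset_graph G H S =
     \<lparr>verts = rcosets\<^bsub>G\<^esub> H, arcs = (rcosets\<^bsub>G\<^esub> H) \<times> S,
      tail = fst, head = (\<lambda>(C, s). C #>\<^bsub>G\<^esub> s)\<rparr>"

definition has_property_tau :: "('a, 'c) monoid_scheme \<Rightarrow> 'a set set \<Rightarrow> bool" where
  "has_property_tau G \<H> \<longleftrightarrow>
     (\<exists>S. finite S \<and> S \<subseteq> carrier G \<and> generate G S = carrier G \<and>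
          (INF H\<in>\<H>. cheeger_constant (schreier_coset_graph G H S)) > 0)"

end

theory Submission
  imports Defs
begin

text \<open>
  The lamplighter group is amenable: the configurations with the lamplighter in \<open>{0..<n}\<close> and all
  lit lamps in \<open>{-R..n + R}\<close> form Folner sets. A Folner set \<open>A\<close> bounds the Cheeger constant of
  every Schreier coset graph with at least \<open>2 |A|\<close> vertices: the function counting the elements of
  \<open>A\<close> in each coset has total mass \<open>|A|\<close>, support of size at most \<open>|A|\<close> and small total variation,
  so by the coarea formula one of its superlevel sets has small boundary. Since a finitely generated
  group has only finitely many subgroups of each index, an infinite collection contains subgroups of
  index as large as needed.
\<close>

section \<open>A coarea bound for the Cheeger constant\<close>

lemma sum_card_fibres:
  assumes "finite B" "finite V" "g ` B \<subseteq> V"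
  shows "(\<Sum>v\<in>V. card {a \<in> B. g a = v}) = card B"
proof -
  have "(\<Sum>v\<in>V. \<Sum>a\<in>{a \<in> B. g a = v}. 1) = (\<Sum>a\<in>B. 1::nat)"
    by (rule sum.group) (use assms in auto)
  then show ?thesis by simp
qed

text \<open>Summed over levels \<open>t \<ge> 1\<close>, the sizes of the superlevel sets of
  \<open>f\<close> give its mass and the sizes of their boundaries give its total variation. Hence
  some nonempty superlevel set has ratio at most \<epsilon>; it lies in the support of
  \<open>f\<close>, so it is small enough to compete in the Cheeger constant.\<close>

lemma cheeger_constant_le_variation:
  fixes f :: "'a \<Rightarrow> nat"
  assumes "fin_digraph X"
    and variation: "(\<Sum>e\<in>arcs X. \<bar>real (f (tail X e)) - real (f (head X e))\<bar>)
      \<le> \<epsilon> * (\<Sum>v\<in>verts X. real (f v))"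
    and nonzero: "v0 \<in> verts X" "f v0 > 0"
    and support: "2 * card {v \<in> verts X. f v > 0} \<le> card (verts X)"
  shows "cheeger_constant X \<le> ereal \<epsilon>"
proof -
  interpret fin_digraph X by fact
  \<comment> \<open>The total mass serves as an upper bound for \<open>f\<close>, so the levels
    \<open>1..M\<close> cover all positive values of \<open>f\<close>.\<close>
  define M where "M = (\<Sum>v\<in>verts X. f v)"
  define L where "L t = {v \<in> verts X. t \<le> f v}" for t
  have fM: "f v \<le> M" if "v \<in> verts X" for v
    unfolding M_def using that by (intro member_le_sum) auto
  have finL: "finite (L t)" for t by (simp add: L_def)
  have "(\<Sum>t\<in>{1..M}. card (L t)) = (\<Sum>v\<in>verts X. card {t \<in> {1..M}. t \<le> f v})"
    unfolding L_def by (rule sum_multicount_gen) auto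
  also have "\<dots> = (\<Sum>v\<in>verts X. f v)"
  proof (rule sum.cong)
    fix v assume "v \<in> verts X"
    with fM have "{t \<in> {1..M}. t \<le> f v} = {1..f v}" by (auto intro: order_trans)
    then show "card {t \<in> {1..M}. t \<le> f v} = f v" by simp
  qed simp
  finally have layers: "(\<Sum>t\<in>{1..M}. real (card (L t))) = (\<Sum>v\<in>verts X. real (f v))"
    by (simp flip: of_nat_sum)
  have "(\<Sum>t\<in>{1..M}. card (edge_boundary X (L t)))
      = (\<Sum>e\<in>arcs X. card {t \<in> {1..M}. (tail X e \<in> L t) \<noteq> (head X e \<in> L t)})"
    unfolding edge_boundary_def by (rule sum_multicount_gen) auto
  then have "(\<Sum>t\<in>{1..M}. real (card (edge_boundary X (L t))))
      = (\<Sum>e\<in>arcs X. real (card {t \<in> {1..M}. (tail X e \<in> L t) \<noteq> (head X e \<in> L t)}))"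
    by (simp flip: of_nat_sum)
  also have "\<dots> = (\<Sum>e\<in>arcs X. \<bar>real (f (tail X e)) - real (f (head X e))\<bar>)"
  proof (rule sum.cong)
    fix e assume e: "e \<in> arcs X"
    let ?a = "f (tail X e)" and ?b = "f (head X e)"
    have "?a \<le> M" "?b \<le> M" using e fM by auto
    \<comment> \<open>An arc crosses the boundary of \<open>L t\<close> exactly when
      \<open>t\<close> exceeds the smaller end value and is at most the larger one, so the number of
      such levels is the difference of the values.\<close>
    then have "{t \<in> {1..M}. (tail X e \<in> L t) \<noteq> (head X e \<in> L t)} = {min ?a ?b<..max ?a ?b}"
      using e by (auto simp: L_def)
    then show "real (card {t \<in> {1..M}. (tail X e \<in> L t) \<noteq> (head X e \<in> L t)})
        = \<bar>real ?a - real ?b\<bar>" by (auto simp: min_def max_def)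
  qed simp
  finally have boundary: "(\<Sum>t\<in>{1..M}. real (card (edge_boundary X (L t))))
      \<le> (\<Sum>t\<in>{1..M}. \<epsilon> * real (card (L t)))"
    using variation by (simp only: layers sum_distrib_left [symmetric])
  \<comment> \<open>Level 1 provides the strict inequality in the contradiction below; levels with
    \<open>L t\<close> empty give only a weak one.\<close>
  have L1: "L 1 \<noteq> {}" and M1: "1 \<in> {1..M}"
    using nonzero fM [of v0] by (auto simp: L_def Suc_le_eq)
  have "\<exists>t\<in>{1..M}. L t \<noteq> {} \<and> real (card (edge_boundary X (L t))) \<le> \<epsilon> * real (card (L t))"
  proof (rule ccontr)
    assume "\<not> ?thesis"
    then have *: "\<epsilon> * real (card (L t)) < real (card (edge_boundary X (L t)))"
      if "t \<in> {1..M}" "L t \<noteq> {}" for t using that by force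
    have "(\<Sum>t\<in>{1..M}. \<epsilon> * real (card (L t))) < (\<Sum>t\<in>{1..M}. real (card (edge_boundary X (L t))))"
    proof (rule sum_strict_mono_ex1)
      show "\<forall>t\<in>{1..M}. \<epsilon> * real (card (L t)) \<le> real (card (edge_boundary X (L t)))"
        using * by (metis card.empty less_imp_le mult_zero_right of_nat_0 of_nat_0_le_iff)
      show "\<exists>t\<in>{1..M}. \<epsilon> * real (card (L t)) < real (card (edge_boundary X (L t)))"
        using * [OF M1 L1] M1 by blast
    qed simp
    with boundary show False by simp
  qed
  then obtain t where t: "t \<in> {1..M}" "L t \<noteq> {}"
    and le: "real (card (edge_boundary X (L t))) \<le> \<epsilon> * real (card (L t))" by blast
  have pos: "0 < card (L t)" using t finL by (simp add: card_gt_0_iff)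
  have "card (L t) \<le> card {v \<in> verts X. f v > 0}"
    using t by (intro card_mono) (auto simp: L_def)
  with support have half: "real (card (L t)) \<le> real (card (verts X)) / 2" by simp
  have "cheeger_constant X \<le> ereal (real (card (edge_boundary X (L t))) / real (card (L t)))"
    unfolding cheeger_constant_def
    by (rule Inf_lower) (use pos half in \<open>auto simp: L_def\<close>)
  also have "\<dots> \<le> ereal \<epsilon>" using le pos by (simp add: divide_le_eq)
  finally show ?thesis .
qed

section \<open>Folner sets and Schreier coset graphs\<close>

context group
begin

lemma rcoset_closed:
  assumes "subgroup H G" "C \<in> rcosets H" "s \<in> carrier G"
  shows "C #> s \<in> rcosets H"
  using assms by (auto simp: RCOSETS_def coset_mult_assoc subgroup.subset)

lemma rcoset_subset:
  assumes "subgroup H G" "C \<in> rcosets H"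
  shows "C \<subseteq> carrier G"
  using assms subgroup.rcosets_carrier is_group by blast

lemma rcoset_mult_inv:
  assumes "C \<subseteq> carrier G" "s \<in> carrier G"
  shows "C #> s #> inv s = C" "C #> inv s #> s = C"
  using assms by (simp_all add: coset_mult_assoc)

lemma fin_digraph_schreier_coset_graph:
  assumes "subgroup H G" "finite (rcosets H)" "finite S" "S \<subseteq> carrier G"
  shows "fin_digraph (schreier_coset_graph G H S)"
  by standard (use assms in \<open>auto simp: schreier_coset_graph_def intro!: rcoset_closed\<close>)

text \<open>Right multiplication by \<open>s\<close> carries the part of \<open>A\<close> in the
  coset \<open>C\<close> into \<open>C #> s\<close>, so the counts on the two cosets differ only
  through elements that leave \<open>A\<close> under \<open>s\<close> or \<open>inv s\<close>. These
  two kinds of escape give the factor 2, and the sum over generators gives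
  \<open>card S\<close>.\<close>

lemma cheeger_constant_schreier_coset_graph_le:
  assumes S: "finite S" "S \<subseteq> carrier G"
    and H: "subgroup H G" "finite (rcosets H)"
    and A: "finite A" "A \<noteq> {}" "A \<subseteq> carrier G"
    and escape: "\<And>s. s \<in> S \<Longrightarrow> real (card {a \<in> A. a \<otimes> s \<notin> A}) \<le> \<delta> * real (card A)"
      "\<And>s. s \<in> S \<Longrightarrow> real (card {a \<in> A. a \<otimes> inv s \<notin> A}) \<le> \<delta> * real (card A)"
    and large: "2 * card A \<le> card (rcosets H)"
  shows "cheeger_constant (schreier_coset_graph G H S) \<le> ereal (2 * \<delta> * real (card S))"
proof -
  define f where "f C = card {a \<in> A. H #> a = C}" for C
  let ?V = "rcosets H"
  note HG = subgroup.subset [OF H(1)]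
  have im: "(#>) H ` A \<subseteq> ?V" using A HG by (auto intro: rcosetsI)
  have total: "(\<Sum>C\<in>?V. f C) = card A"
    unfolding f_def by (rule sum_card_fibres) (use A H im in auto)
  have f_le: "f C \<le> f (C #> s) + card {a \<in> A. H #> a = C \<and> a \<otimes> s \<notin> A}"
    if "s \<in> carrier G" for C s
  proof -
    have "card {a \<in> A. H #> a = C \<and> a \<otimes> s \<in> A} \<le> f (C #> s)"
      unfolding f_def
    proof (rule card_inj_on_le [where f = "\<lambda>a. a \<otimes> s"])
      show "inj_on (\<lambda>a. a \<otimes> s) {a \<in> A. H #> a = C \<and> a \<otimes> s \<in> A}"
        using A that by (auto intro!: inj_onI simp: subset_iff)
    qed (use A HG that in \<open>auto simp: coset_mult_assoc\<close>)
    moreover have "f C = card ({a \<in> A. H #> a = C \<and> a \<otimes> s \<in> A} \<union> {a \<in> A. H #> a = C \<and> a \<otimes> s \<notin> A})"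
      unfolding f_def by (rule arg_cong [where f = card]) auto
    ultimately show ?thesis
      using card_Un_le [of "{a \<in> A. H #> a = C \<and> a \<otimes> s \<in> A}"
          "{a \<in> A. H #> a = C \<and> a \<otimes> s \<notin> A}"] by linarith
  qed
  have var: "(\<Sum>C\<in>?V. \<bar>real (f C) - real (f (C #> s))\<bar>) \<le> 2 * \<delta> * real (card A)" if s: "s \<in> S" for s
  proof -
    have sG: "s \<in> carrier G" using s S by auto
    have "\<bar>real (f C) - real (f (C #> s))\<bar>
        \<le> real (card {a \<in> {a \<in> A. a \<otimes> s \<notin> A}. H #> a = C})
          + real (card {a \<in> {a \<in> A. a \<otimes> inv s \<notin> A}. H #> (a \<otimes> inv s) = C})" if C: "C \<in> ?V" for C
    proof -
      have CG: "C \<subseteq> carrier G" using rcoset_subset H C by blast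
      \<comment> \<open>The reverse estimate is \<open>f_le\<close> for \<open>inv s\<close> at
        \<open>C #> s\<close>. Its error term is reindexed by the coset of
        \<open>a \<otimes> inv s\<close>, so that summing over \<open>C\<close> counts each escaping
        element once.\<close>
      have "H #> a = C #> s \<longleftrightarrow> H #> (a \<otimes> inv s) = C" if "a \<in> A" for a
      proof -
        have "a \<in> carrier G" using that A by auto
        then have "H #> a \<subseteq> carrier G" "H #> (a \<otimes> inv s) = H #> a #> inv s"
          using HG sG by (simp_all add: r_coset_subset_G coset_mult_assoc)
        then show ?thesis
          using rcoset_mult_inv [OF CG sG] rcoset_mult_inv [of "H #> a" s] sG by auto
      qed
      then have "{a \<in> A. H #> a = C #> s \<and> a \<otimes> inv s \<notin> A}
          = {a \<in> {a \<in> A. a \<otimes> inv s \<notin> A}. H #> (a \<otimes> inv s) = C}" by auto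
      moreover have "{a \<in> A. H #> a = C \<and> a \<otimes> s \<notin> A} = {a \<in> {a \<in> A. a \<otimes> s \<notin> A}. H #> a = C}"
        by auto
      ultimately show ?thesis
        using f_le [OF sG, of C] f_le [of "inv s" "C #> s"] sG rcoset_mult_inv [OF CG sG] by simp
    qed
    then have "(\<Sum>C\<in>?V. \<bar>real (f C) - real (f (C #> s))\<bar>)
        \<le> (\<Sum>C\<in>?V. real (card {a \<in> {a \<in> A. a \<otimes> s \<notin> A}. H #> a = C})
          + real (card {a \<in> {a \<in> A. a \<otimes> inv s \<notin> A}. H #> (a \<otimes> inv s) = C}))"
      by (rule sum_mono)
    also have "\<dots> = real (\<Sum>C\<in>?V. card {a \<in> {a \<in> A. a \<otimes> s \<notin> A}. H #> a = C})
          + real (\<Sum>C\<in>?V. card {a \<in> {a \<in> A. a \<otimes> inv s \<notin> A}. H #> (a \<otimes> inv s) = C})"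
      by (simp add: sum.distrib)
    also have "\<dots> = real (card {a \<in> A. a \<otimes> s \<notin> A}) + real (card {a \<in> A. a \<otimes> inv s \<notin> A})"
    proof -
      have "(\<Sum>C\<in>?V. card {a \<in> {a \<in> A. a \<otimes> s \<notin> A}. H #> a = C}) = card {a \<in> A. a \<otimes> s \<notin> A}"
        by (rule sum_card_fibres) (use A H im in auto)
      moreover have "(\<Sum>C\<in>?V. card {a \<in> {a \<in> A. a \<otimes> inv s \<notin> A}. H #> (a \<otimes> inv s) = C})
          = card {a \<in> A. a \<otimes> inv s \<notin> A}"
        by (rule sum_card_fibres) (use A H HG sG in \<open>auto intro!: rcosetsI\<close>)
      ultimately show ?thesis by simp
    qed
    also have "\<dots> \<le> 2 * \<delta> * real (card A)" using escape [OF s] by simp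
    finally show ?thesis .
  qed
  obtain a where a: "a \<in> A" using A by auto
  show ?thesis
  proof (rule cheeger_constant_le_variation [where f = f and ?v0.0 = "H #> a"])
    let ?X = "schreier_coset_graph G H S"
    show "fin_digraph ?X" using fin_digraph_schreier_coset_graph S H by blast
    have "(\<Sum>e\<in>arcs ?X. \<bar>real (f (tail ?X e)) - real (f (head ?X e))\<bar>)
        = (\<Sum>C\<in>?V. \<Sum>s\<in>S. \<bar>real (f C) - real (f (C #> s))\<bar>)"
      by (simp add: schreier_coset_graph_def sum.cartesian_product case_prod_unfold)
    also have "\<dots> = (\<Sum>s\<in>S. \<Sum>C\<in>?V. \<bar>real (f C) - real (f (C #> s))\<bar>)" by (rule sum.swap)
    also have "\<dots> \<le> (\<Sum>s\<in>S. 2 * \<delta> * real (card A))" by (rule sum_mono) (rule var)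
    also have "\<dots> = 2 * \<delta> * real (card S) * (\<Sum>C\<in>verts ?X. real (f C))"
      using total by (simp add: schreier_coset_graph_def flip: of_nat_sum)
    finally show "(\<Sum>e\<in>arcs ?X. \<bar>real (f (tail ?X e)) - real (f (head ?X e))\<bar>)
        \<le> 2 * \<delta> * real (card S) * (\<Sum>C\<in>verts ?X. real (f C))" .
    show "H #> a \<in> verts ?X" using a im by (auto simp: schreier_coset_graph_def)
    show "f (H #> a) > 0" using a A by (auto simp: f_def card_gt_0_iff)
    \<comment> \<open>The support consists of cosets meeting \<open>A\<close>, hence has at most
      \<open>card A\<close> elements, which is at most half of the vertices.\<close>
    have "{C \<in> ?V. f C > 0} \<subseteq> (#>) H ` A" using A by (auto simp: f_def card_gt_0_iff)
    then have "card {C \<in> ?V. f C > 0} \<le> card A" using A by (meson surj_card_le)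
    then show "2 * card {C \<in> verts ?X. f C > 0} \<le> card (verts ?X)"
      using large by (simp add: schreier_coset_graph_def)
  qed
qed

section \<open>Finiteness of the set of subgroups of bounded index\<close>

text \<open>A subgroup is the stabiliser of a point in the action on its cosets; once the cosets are
  numbered, only finitely many such pointed actions exist.\<close>

lemma finite_subgroups_bounded_index:
  assumes S: "finite S" "S \<subseteq> carrier G" "generate G S = carrier G"
  shows "finite {H. subgroup H G \<and> finite (rcosets H) \<and> card (rcosets H) \<le> n}"
    (is "finite ?K")
proof -
  have "\<forall>H\<in>?K. \<exists>e. e ` (rcosets H) \<subseteq> {..<n} \<and> inj_on e (rcosets H)"
    using card_le_inj [of _ "{..<n}"] by auto
  then obtain e where e: "\<And>H. H \<in> ?K \<Longrightarrow> inj_on (e H) (rcosets H)"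
    "\<And>H. H \<in> ?K \<Longrightarrow> e H ` (rcosets H) \<subseteq> {..<n}"
    unfolding bchoice_iff by blast
  \<comment> \<open>The code is the number of the base coset together with the arcs of the Schreier
    graph, written in terms of the numbering \<open>e H\<close> and labelled by generators. It
    ranges over a finite set, so it remains to recover \<open>H\<close> from it.\<close>
  define code where
    "code H = (e H H, (\<lambda>(C, s). (e H C, s, e H (C #> s))) ` ((rcosets H) \<times> S))" for H
  have self: "H \<in> rcosets H" if "subgroup H G" for H
    using subgroup.subgroup_in_rcosets [OF that is_group] .
  have "code ` ?K \<subseteq> {..<n} \<times> Pow ({..<n} \<times> S \<times> {..<n})"
  proof (rule image_subsetI)
    fix H assume H: "H \<in> ?K"
    then have "e H C < n" if "C \<in> rcosets H" for C using e(2) [OF H] that by auto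
    then show "code H \<in> {..<n} \<times> Pow ({..<n} \<times> S \<times> {..<n})"
      using H S self rcoset_closed by (auto simp: code_def)
  qed
  moreover have "finite ({..<n} \<times> Pow ({..<n} \<times> S \<times> {..<n}))" using S by simp
  ultimately have "finite (code ` ?K)" by (rule finite_subset)
  moreover have "inj_on code ?K"
  proof (rule inj_onI)
    fix H K assume H: "H \<in> ?K" and K: "K \<in> ?K" and eq: "code H = code K"
    have H': "subgroup H G" and K': "subgroup K G" using H K by auto
    have transport: "\<exists>D'\<in>rcosets K. e K D' = e H C \<and> e K (D' #> s) = e H (C #> s)"
      if "C \<in> rcosets H" "s \<in> S" for C s
    proof -
      have "(e H C, s, e H (C #> s)) \<in> snd (code K)"
        unfolding eq [symmetric] using that by (force simp: code_def)
      then show ?thesis by (auto simp: code_def)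
    qed
    \<comment> \<open>Equal codes force equally numbered cosets of \<open>H\<close> and
      \<open>K\<close> to move in step along every word in the generators. For an inverse letter,
      the arc from \<open>C #> inv s\<close> to \<open>C\<close> is transported; injectivity of
      \<open>e K\<close> shows that its copy ends at \<open>D\<close>, hence starts at
      \<open>D #> inv s\<close>.\<close>
    have "e H (C #> g) = e K (D #> g)"
      if "g \<in> generate G S" "C \<in> rcosets H" "D \<in> rcosets K" "e H C = e K D" for g C D
      using that
    proof (induction arbitrary: C D rule: generate.induct)
      case one
      then show ?case using rcoset_subset [OF H'] rcoset_subset [OF K'] by simp
    next
      case (incl s)
      then obtain D' where "D' \<in> rcosets K" "e K D' = e H C" "e K (D' #> s) = e H (C #> s)"
        using transport by blast
      with incl e(1) [OF K] show ?case by (metis inj_onD)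
    next
      case (inv s)
      then have s: "s \<in> carrier G" using S by auto
      have "C #> inv s \<in> rcosets H" using inv s rcoset_closed [OF H'] by simp
      then obtain D' where D': "D' \<in> rcosets K" "e K D' = e H (C #> inv s)"
        "e K (D' #> s) = e H (C #> inv s #> s)"
        using transport inv by blast
      have "C #> inv s #> s = C" using rcoset_mult_inv rcoset_subset [OF H'] inv s by simp
      with D' inv have "e K (D' #> s) = e K D" by simp
      then have "D' #> s = D"
        using e(1) [OF K] inv D' s rcoset_closed [OF K'] by (auto dest: inj_onD)
      then have "D' = D #> inv s" using rcoset_mult_inv(1) [OF rcoset_subset [OF K'] s] D' by blast
      with D' show ?case by simp
    next
      case (eng g h)
      have g: "g \<in> carrier G" "h \<in> carrier G" using eng.hyps S by auto
      have "e H (C #> g #> h) = e K (D #> g #> h)"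
        using eng g rcoset_closed [OF H'] rcoset_closed [OF K'] by simp
      then show ?case using g eng rcoset_subset [OF H'] rcoset_subset [OF K'] by (simp add: coset_mult_assoc)
    qed
    then have tr: "e H (H #> g) = e K (K #> g)" if "g \<in> carrier G" for g
      using that eq self H K S by (simp add: code_def)
    \<comment> \<open>Each subgroup is the stabiliser of its own base coset, and this is visible
      through the numbering.\<close>
    have mem: "g \<in> L \<longleftrightarrow> e L (L #> g) = e L L" if "g \<in> carrier G" "L \<in> ?K" for g L
    proof
      assume "g \<in> L" then show "e L (L #> g) = e L L" using that coset_join2 by simp
    next
      assume "e L (L #> g) = e L L"
      then have "L #> g = L"
        using e(1) [OF that(2)] that self rcoset_closed by (auto dest: inj_onD)
      then show "g \<in> L" using that coset_join1 by auto
    qed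
    have "e H H = e K K" using eq by (simp add: code_def)
    then have "g \<in> H \<longleftrightarrow> g \<in> K" if "g \<in> carrier G" for g
      using tr [OF that] mem [OF that H] mem [OF that K] by simp
    then show "H = K" using H K subgroup.subset by blast
  qed
  ultimately show ?thesis by (rule finite_imageD)
qed

section \<open>From Folner sets to the failure of Property (\<tau>)\<close>

theorem not_has_property_tau_if_folner:
  assumes folner: "\<And>S \<delta>. finite S \<Longrightarrow> S \<subseteq> carrier G \<Longrightarrow> 0 < (\<delta>::real) \<Longrightarrow>
      \<exists>A. finite A \<and> A \<noteq> {} \<and> A \<subseteq> carrier G \<and>
        (\<forall>s\<in>S. real (card {a \<in> A. a \<otimes> s \<notin> A}) \<le> \<delta> * real (card A))"
    and inf: "infinite \<H>"
    and sub: "\<And>H. H \<in> \<H> \<Longrightarrow> subgroup H G"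
    and fin: "\<And>H. H \<in> \<H> \<Longrightarrow> finite (rcosets H)"
  shows "\<not> has_property_tau G \<H>"
proof
  assume "has_property_tau G \<H>"
  then obtain S where S: "finite S" "S \<subseteq> carrier G" "generate G S = carrier G"
    and pos: "(INF H\<in>\<H>. cheeger_constant (schreier_coset_graph G H S)) > 0"
    unfolding has_property_tau_def by blast
  \<comment> \<open>A real number is chosen strictly below the infimum, which may itself be
    infinite.\<close>
  obtain \<epsilon> where \<epsilon>: "0 < ereal \<epsilon>" "ereal \<epsilon> < (INF H\<in>\<H>. cheeger_constant (schreier_coset_graph G H S))"
    using ereal_dense2 [OF pos] by auto
  \<comment> \<open>This makes \<open>2 * \<delta> * card S\<close> at most \<epsilon>; the summand
    1 keeps the denominator positive when \<open>S\<close> is empty.\<close>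
  define \<delta> where "\<delta> = \<epsilon> / (2 * real (card S) + 1)"
  have \<delta>: "\<delta> > 0" using \<epsilon> by (simp add: \<delta>_def)
  obtain A where A: "finite A" "A \<noteq> {}" "A \<subseteq> carrier G"
    and escape: "\<forall>s \<in> S \<union> m_inv G ` S. real (card {a \<in> A. a \<otimes> s \<notin> A}) \<le> \<delta> * real (card A)"
    \<comment> \<open>Adjoining the inverses yields both escape bounds from a one-sided Folner
      condition.\<close>
    using folner [of "S \<union> m_inv G ` S" \<delta>] S \<delta> by auto
  have "finite {H. subgroup H G \<and> finite (rcosets H) \<and> card (rcosets H) \<le> 2 * card A}"
    using finite_subgroups_bounded_index S by blast
  then obtain H where H: "H \<in> \<H>" "card (rcosets H) > 2 * card A"
    using inf sub fin
    by (metis (mono_tags, lifting) finite_subset mem_Collect_eq not_le subsetI)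
  have "cheeger_constant (schreier_coset_graph G H S) \<le> ereal (2 * \<delta> * real (card S))"
    by (rule cheeger_constant_schreier_coset_graph_le [where A = A]) (use S A escape H sub fin in auto)
  also have "\<dots> \<le> ereal \<epsilon>"
  proof -
    have "2 * \<delta> * real (card S) \<le> \<delta> * (2 * real (card S) + 1)" using \<delta> by (simp add: algebra_simps)
    also have "\<dots> = \<epsilon>" by (simp add: \<delta>_def)
    finally show ?thesis by simp
  qed
  also have "\<dots> < cheeger_constant (schreier_coset_graph G H S)"
    using \<epsilon> H by (meson INF_lower less_le_trans)
  finally show False by simp
qed

end

section \<open>Folner sets in the lamplighter group\<close>

lemma carrier_lamplighter_group:
  "carrier (lamplighter_group p) =
    {f. (\<forall>i. f i \<in> carrier (integer_mod_group p)) \<and> finite {i. f i \<noteq> 0}} \<times> UNIV"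
proof -
  have "carrier (sum_group (UNIV :: int set) (\<lambda>_. integer_mod_group p)) =
      {f. (\<forall>i. f i \<in> carrier (integer_mod_group p)) \<and> finite {i. f i \<noteq> 0}}"
    by (auto simp: carrier_sum_group PiE_def)
  then show ?thesis
    by (simp add: lamplighter_group_def semidirect_product_def)
qed

lemma mult_lamplighter_group:
  "(f, k) \<otimes>\<^bsub>lamplighter_group p\<^esub> (g, m) = (\<lambda>i. (f i + g (i - k)) mod int p, k + m)"
  by (simp add: lamplighter_group_def semidirect_product_def shift_def restrict_def)

text \<open>Right multiplication by \<open>(g, m)\<close> changes lamps at the positions of
  \<open>g\<close> relative to the lamplighter and then moves the lamplighter by \<open>m\<close>.
  With a lamp window exceeding the walking range by \<open>R\<close> on both sides, an element can
  leave the set only if the lamplighter leaves \<open>{0..<n}\<close>. This affects at most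
  \<open>R\<close> of the \<open>n\<close> positions, a proportion of at most \<delta>.\<close>

lemma lamplighter_group_folner:
  fixes \<delta> :: real
  assumes p: "p > 0" and S: "finite S" "S \<subseteq> carrier (lamplighter_group p)" and \<delta>: "\<delta> > 0"
  shows "\<exists>A. finite A \<and> A \<noteq> {} \<and> A \<subseteq> carrier (lamplighter_group p) \<and>
    (\<forall>s\<in>S. real (card {a \<in> A. a \<otimes>\<^bsub>lamplighter_group p\<^esub> s \<notin> A}) \<le> \<delta> * real (card A))"
proof -
  \<comment> \<open>\<open>Z\<close> collects all displacements and lit lamp positions occurring in
    \<open>S\<close>; the sum of absolute values is a convenient bound \<open>R\<close> for all of
    them.\<close>
  define Z where "Z = (\<Union>s\<in>S. insert (snd s) {i. fst s i \<noteq> 0})"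
  have "finite Z" using S by (auto simp: Z_def carrier_lamplighter_group)
  define R where "R = (\<Sum>x\<in>Z. \<bar>x\<bar>)"
  have "\<bar>x\<bar> \<le> R" if "x \<in> Z" for x
    unfolding R_def using that \<open>finite Z\<close> by (intro member_le_sum) auto
  then have R: "\<bar>m\<bar> \<le> R" "\<And>i. g i \<noteq> 0 \<Longrightarrow> \<bar>i\<bar> \<le> R" if "(g, m) \<in> S" for g m
    using that by (force simp: Z_def)+
  have "R \<ge> 0" by (simp add: R_def sum_nonneg)
  obtain n0 :: nat where "real_of_int R < real n0 * \<delta>"
    using reals_Archimedean3 [OF \<delta>] by blast
  then obtain n :: nat where n: "n > 0" "real_of_int R \<le> \<delta> * real n"
    using \<open>R \<ge> 0\<close> by (cases "n0 = 0") (auto simp: mult.commute)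
  define I where "I = {-R..int n + R}"
  define F where "F = {f. (\<forall>i. f i \<in> {0..<int p}) \<and> (\<forall>i. i \<notin> I \<longrightarrow> f i = 0)}"
  have "finite F"
  proof (rule finite_subset)
    show "F \<subseteq> {f. \<forall>i. (i \<in> I \<longrightarrow> f i \<in> {0..<int p}) \<and> (i \<notin> I \<longrightarrow> f i = 0)}"
      by (auto simp: F_def)
    show "finite {f. \<forall>i. (i \<in> I \<longrightarrow> f i \<in> {0..<int p}) \<and> (i \<notin> I \<longrightarrow> f i = 0)}"
      by (rule finite_set_of_finite_funs) (auto simp: I_def)
  qed
  have "(\<lambda>_. 0) \<in> F" using p by (auto simp: F_def)
  let ?A = "F \<times> {0..<int n}"
  have mult_F: "(\<lambda>i. (f i + g (i - k)) mod int p) \<in> F"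
    if "f \<in> F" "0 \<le> k" "k < int n" "(g, m) \<in> S" for f g k m
  proof -
    \<comment> \<open>A lamp outside \<open>I\<close> is at distance more than \<open>R\<close> from
      every lamplighter position in \<open>{0..<n}\<close>, beyond the reach of
      \<open>g\<close>.\<close>
    have "g (i - k) = 0" if "i \<notin> I" for i
      using R(2) [OF \<open>(g, m) \<in> S\<close>, of "i - k"] that \<open>0 \<le> k\<close> \<open>k < int n\<close> by (force simp: I_def)
    then show ?thesis using that p by (auto simp: F_def)
  qed
  have "real (card {a \<in> ?A. a \<otimes>\<^bsub>lamplighter_group p\<^esub> s \<notin> ?A}) \<le> \<delta> * real (card ?A)" if "s \<in> S" for s
  proof -
    obtain g m where s: "s = (g, m)" by force
    with that have gm: "(g, m) \<in> S" by simp
    define B where "B = {k \<in> {0..<int n}. k + m \<notin> {0..<int n}}"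
    have "finite B" by (rule finite_subset [of _ "{0..<int n}"]) (auto simp: B_def)
    have "card B \<le> nat R"
    proof -
      \<comment> \<open>Only the last \<open>m\<close> positions, or the first \<open>-m\<close> for
        negative \<open>m\<close>, can be moved out of the interval.\<close>
      have "B \<subseteq> (if m \<ge> 0 then {int n - m..<int n} else {0..<-m})" by (auto simp: B_def)
      then have "card B \<le> card (if m \<ge> 0 then {int n - m..<int n} else {0..<-m})"
        by (rule card_mono [rotated]) auto
      also have "\<dots> \<le> nat R" using R(1) [OF gm] by auto
      finally show ?thesis .
    qed
    have "{a \<in> ?A. a \<otimes>\<^bsub>lamplighter_group p\<^esub> s \<notin> ?A} \<subseteq> F \<times> B"
      using mult_F gm by (auto simp: s B_def mult_lamplighter_group)
    then have "card {a \<in> ?A. a \<otimes>\<^bsub>lamplighter_group p\<^esub> s \<notin> ?A} \<le> card (F \<times> B)"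
      by (rule card_mono [rotated]) (use \<open>finite F\<close> \<open>finite B\<close> in auto)
    also have "\<dots> \<le> card F * nat R" using \<open>card B \<le> nat R\<close> by (simp add: card_cartesian_product)
    finally have "real (card {a \<in> ?A. a \<otimes>\<^bsub>lamplighter_group p\<^esub> s \<notin> ?A}) \<le> real (card F * nat R)"
      by (simp only: of_nat_le_iff)
    also have "\<dots> = real (card F) * real_of_int R" using R(1) [OF gm] by simp
    also have "\<dots> \<le> real (card F) * (\<delta> * real n)" using n by (intro mult_left_mono) auto
    also have "\<dots> = \<delta> * real (card ?A)" by (simp add: card_cartesian_product)
    finally show ?thesis .
  qed
  moreover have "?A \<subseteq> carrier (lamplighter_group p)"
  proof -
    have "finite {i. f i \<noteq> 0}" if "f \<in> F" for f
      by (rule finite_subset [of _ I]) (use that in \<open>auto simp: F_def I_def\<close>)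
    then show ?thesis
      using p by (auto simp: carrier_lamplighter_group carrier_integer_mod_group F_def)
  qed
  ultimately show ?thesis
    using \<open>finite F\<close> \<open>(\<lambda>_. 0) \<in> F\<close> n by (intro exI [of _ ?A]) auto
qed

theorem proposition7p2:
  fixes p :: nat and \<H> :: "((int \<Rightarrow> int) \<times> int) set set"
  assumes "prime p"
    and "infinite \<H>"
    and "\<And>H. H \<in> \<H> \<Longrightarrow> subgroup H (lamplighter_group p)"
    and "\<And>H. H \<in> \<H> \<Longrightarrow> finite (rcosets\<^bsub>lamplighter_group p\<^esub> H)"
  shows "\<not> has_property_tau (lamplighter_group p) \<H>"
proof (rule group.not_has_property_tau_if_folner [OF group_lamplighter_group _ assms(2)])
  show "\<exists>A. finite A \<and> A \<noteq> {} \<and> A \<subseteq> carrier (lamplighter_group p) \<and>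
      (\<forall>s\<in>S. real (card {a \<in> A. a \<otimes>\<^bsub>lamplighter_group p\<^esub> s \<notin> A}) \<le> \<delta> * real (card A))"
    if "finite S" "S \<subseteq> carrier (lamplighter_group p)" "0 < \<delta>" for S and \<delta> :: real
    using lamplighter_group_folner that prime_gt_0_nat [OF assms(1)] by blast
qed (use assms in auto)

end
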